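(* There exists an absolute constant $c>0$ such that, for any integers $s,d$ satisfying $1\le s\le d$, and any $\kappa,\sigma>0$, $$\inf_{\hat T}\sup_{\theta\in B_2(\kappa)\cap B_0(s)} \mathbf E_\theta\big(\hat T - Q(\theta)\big)^2 \ge c\,\psi^Q_\sigma(s,d,\kappa),$$ where $\inf_{\hat T}$ is the infimum over all estimators.
   Context: Model: one observes $y_j=\theta_j+\sigma\xi_j$, $j=1,\dots,d$, where $\theta=(\theta_1,\dots,\theta_d)\in\mathbb R^d$ is unknown, $\xi_1,\dots,\xi_d$ are i.i.d. standard normal and $\sigma>0$. $\mathbf P_\theta$ is the law of $(y_1,\dots,y_d)$ and $\mathbf E_\theta$ the corresponding expectation. An estimator is a measurable real-valued function of $(y_1,\dots,y_d)$ (it may depend on known parameters). $Q(\theta)=\sum_{i=1}^d\theta_i^2$; $\|\theta\|_2=\sqrt{Q(\theta)}$; $\|\theta\|_0$ is the number of non-zero components of $\theta$; $B_0(s)=\{\theta\in\mathbb R^d:\|\theta\|_0\le s\}$; $B_2(\kappa)=\{\theta\in\mathbb R^d:\|\theta\|_2\le\kappa\}$. $$\bar\psi_\sigma(s,d)=\begin{cases}\sigma^4s^2\log^2(1+d/s^2)&\text{if } s<\sqrt d,\\ \sigma^4d&\text{if } s\ge\sqrt d,\end{cases}\qquad \psi^Q_\sigma(s,d,\kappa)=\min\{\kappa^4,\max\{\sigma^2\kappa^2,\bar\psi_\sigma(s,d)\}\}.$$ *)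

theory Defs
  imports "HOL-Probability.Probability"
begin

text \<open>
  The dimension \<open>d\<close> is quantified after the absolute constant, so it cannot be a type parameter:
  points of \<open>\<real>\<^sup>d\<close> are the extensional functions on the index set \<open>{1..d}\<close>, i.e. exactly the
  points of the product Borel space below.
\<close>

abbreviation vec_space :: "nat \<Rightarrow> (nat \<Rightarrow> real) measure" where
  "vec_space d \<equiv> \<Pi>\<^sub>M j\<in>{1..d}. (borel :: real measure)"

definition noise_law :: "nat \<Rightarrow> (nat \<Rightarrow> real) measure" where
  "noise_law d = (\<Pi>\<^sub>M j\<in>{1..d}. std_normal_distribution)"

definition obs_law :: "nat \<Rightarrow> real \<Rightarrow> (nat \<Rightarrow> real) \<Rightarrow> (nat \<Rightarrow> real) measure" where
  "obs_law d \<sigma> \<theta> =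
     distr (noise_law d) (vec_space d) (\<lambda>\<xi>. \<lambda>j\<in>{1..d}. \<theta> j + \<sigma> * \<xi> j)"

definition estimators :: "nat \<Rightarrow> ((nat \<Rightarrow> real) \<Rightarrow> real) set" where
  "estimators d = borel_measurable (vec_space d)"

definition Q :: "nat \<Rightarrow> (nat \<Rightarrow> real) \<Rightarrow> real" where
  "Q d \<theta> = (\<Sum>i=1..d. (\<theta> i)\<^sup>2)"

definition norm2 :: "nat \<Rightarrow> (nat \<Rightarrow> real) \<Rightarrow> real" where
  "norm2 d \<theta> = sqrt (Q d \<theta>)"

definition norm0 :: "nat \<Rightarrow> (nat \<Rightarrow> real) \<Rightarrow> nat" where
  "norm0 d \<theta> = card {i \<in> {1..d}. \<theta> i \<noteq> 0}"

definition B0 :: "nat \<Rightarrow> nat \<Rightarrow> (nat \<Rightarrow> real) set" where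
  "B0 d s = {\<theta> \<in> space (vec_space d). norm0 d \<theta> \<le> s}"

definition B2 :: "nat \<Rightarrow> real \<Rightarrow> (nat \<Rightarrow> real) set" where
  "B2 d \<kappa> = {\<theta> \<in> space (vec_space d). norm2 d \<theta> \<le> \<kappa>}"

text \<open>
  The risk is a Lebesgue integral in \<open>[0, \<infinity>]\<close>, since it may be infinite for some estimators
  (the Bochner integral would then be 0).
\<close>

definition risk ::
  "nat \<Rightarrow> real \<Rightarrow> ((nat \<Rightarrow> real) \<Rightarrow> real) \<Rightarrow> (nat \<Rightarrow> real) \<Rightarrow> ennreal" where
  "risk d \<sigma> T \<theta> = (\<integral>\<^sup>+ y. ennreal ((T y - Q d \<theta>)\<^sup>2) \<partial>obs_law d \<sigma> \<theta>)"

definition psi_bar :: "real \<Rightarrow> nat \<Rightarrow> nat \<Rightarrow> real" where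
  "psi_bar \<sigma> s d =
     (if real s < sqrt (real d)
      then \<sigma> ^ 4 * (real s)\<^sup>2 * (ln (1 + real d / (real s)\<^sup>2))\<^sup>2
      else \<sigma> ^ 4 * real d)"

definition psi_Q :: "real \<Rightarrow> nat \<Rightarrow> nat \<Rightarrow> real \<Rightarrow> real" where
  "psi_Q \<sigma> s d \<kappa> = min (\<kappa> ^ 4) (max (\<sigma>\<^sup>2 * \<kappa>\<^sup>2) (psi_bar \<sigma> s d))"

end

theory Submission
  imports Defs
begin

text \<open>
  Fix a base point \<open>\<eta>\<close> and finitely many alternatives \<open>\<theta>\<^sub>i\<close> whose functionals share one value,
  at distance \<open>\<delta>\<close> from \<open>Q(\<eta>)\<close>, and let \<open>f\<close> be the averaged likelihood ratio. Bounding
  \<open>\<^bold>E\<^sub>\<eta>(f\<^sup>2) \<le> C\<close> makes the worst risk at least \<open>\<delta>\<^sup>2 / (2 (1 + C))\<close>, and Gaussian shifts give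
  \<open>\<^bold>E\<^sub>\<eta>(f\<^sup>2)\<close> as the average of \<open>exp (\<langle>\<theta>\<^sub>i - \<eta>, \<theta>\<^sub>k - \<eta>\<rangle> / \<sigma>\<^sup>2)\<close>. Two points on a coordinate axis,
  at distance \<open>min \<kappa> \<sigma>\<close>, yield the term \<open>\<sigma>\<^sup>2 \<kappa>\<^sup>2\<close>. For the term \<open>psi_bar\<close> the base point is 0,
  the coordinates are cut into \<open>s\<close> blocks of size \<open>m = d div s\<close>, and an alternative has one
  coordinate equal to \<open>\<rho>\<close> in each block: two random supports then overlap in a
  binomial number of coordinates, so with \<open>\<rho>\<^sup>2 \<le> \<sigma>\<^sup>2 ln (1 + d / (2 s\<^sup>2))\<close> the average is at most
  \<open>(1 + 1/s)\<^sup>s \<le> exp 1\<close>. If \<open>s \<ge> sqrt d\<close>, one uses \<open>\<lfloor>sqrt d\<rfloor>\<close> in place of \<open>s\<close>.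
\<close>

declare One_nat_def [simp del]

section \<open>Gaussian shifts and their likelihood ratios\<close>

lemma nn_integral_std_normal_shift:
  fixes g :: "real \<Rightarrow> ennreal"
  assumes [measurable]: "g \<in> borel_measurable borel"
  shows "(\<integral>\<^sup>+x. g (x + a) \<partial>std_normal_distribution)
    = (\<integral>\<^sup>+x. ennreal (exp (a * x - a\<^sup>2 / 2)) * g x \<partial>std_normal_distribution)"
proof -
  \<comment> \<open>Completing the square: the exponential tilt moves the centre of the density from
    0 to \<open>a\<close>.\<close>
  have *: "std_normal_density x * exp (a * x - a\<^sup>2 / 2) = std_normal_density (x - a)" for x
    by (simp add: std_normal_density_def exp_add [symmetric] power2_eq_square field_simps)
  have "(\<integral>\<^sup>+x. ennreal (exp (a * x - a\<^sup>2 / 2)) * g x \<partial>std_normal_distribution)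
      = (\<integral>\<^sup>+x. ennreal (std_normal_density (x - a)) * g x \<partial>lborel)"
    by (subst nn_integral_density)
       (auto simp: mult.assoc [symmetric] ennreal_mult [symmetric] * intro!: nn_integral_cong)
  also have "\<dots> = (\<integral>\<^sup>+x. ennreal (std_normal_density x) * g (x + a) \<partial>lborel)"
    by (subst nn_integral_real_affine [where c = 1 and t = a]) (auto simp: add.commute)
  also have "\<dots> = (\<integral>\<^sup>+x. g (x + a) \<partial>std_normal_distribution)"
    by (subst nn_integral_density) auto
  finally show ?thesis ..
qed

lemma prob_space_std_normal: "prob_space std_normal_distribution"
  by (simp add: prob_space_normal_density)

lemma prob_space_noise_law: "prob_space (noise_law d)"
  unfolding noise_law_def by (intro prob_space_PiM prob_space_std_normal)

lemma sets_noise_law [measurable_cong, simp]: "sets (noise_law d) = sets (vec_space d)"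
  unfolding noise_law_def by (intro sets_PiM_cong) auto

lemma space_noise_law [simp]: "space (noise_law d) = space (vec_space d)"
  by (rule sets_eq_imp_space_eq) simp

definition transl :: "nat \<Rightarrow> (nat \<Rightarrow> real) \<Rightarrow> (nat \<Rightarrow> real) \<Rightarrow> nat \<Rightarrow> real" where
  "transl d a \<xi> = (\<lambda>j\<in>{1..d}. \<xi> j + a j)"

text \<open>The Cameron-Martin density: likelihood ratio of the noise shifted by \<open>a\<close>
  against the unshifted noise.\<close>

definition lik :: "nat \<Rightarrow> (nat \<Rightarrow> real) \<Rightarrow> (nat \<Rightarrow> real) \<Rightarrow> real" where
  "lik d a \<xi> = exp ((\<Sum>j=1..d. a j * \<xi> j) - (\<Sum>j=1..d. (a j)\<^sup>2) / 2)"

lemma measurable_transl [measurable]: "transl d a \<in> measurable (vec_space d) (vec_space d)"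
  unfolding transl_def by measurable

lemma measurable_lik [measurable]: "lik d a \<in> borel_measurable (vec_space d)"
  unfolding lik_def by measurable

lemma lik_pos: "lik d a \<xi> > 0"
  by (simp add: lik_def)

lemma lik_prod: "lik d a \<xi> = (\<Prod>j=1..d. exp (a j * \<xi> j - (a j)\<^sup>2 / 2))"
  by (simp add: lik_def exp_sum [symmetric] sum_subtractf sum_divide_distrib)

text \<open>Both sides are the product of the shifted one-dimensional laws \<open>N j\<close>,
  because they agree with it on boxes. On a box the density factorises over the coordinates, and the
  one-dimensional shift formula evaluates each factor.\<close>

lemma distr_noise_law_shift:
  "distr (noise_law d) (vec_space d) (transl d a) = density (noise_law d) (\<lambda>\<xi>. ennreal (lik d a \<xi>))"
proof -
  define N where "N j = distr std_normal_distribution borel (\<lambda>x. x + a j)" for j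
  interpret S: product_prob_space "\<lambda>_. std_normal_distribution" "{1..d}"
    by (intro product_prob_spaceI prob_space_std_normal)
  interpret N: product_prob_space N "{1..d}"
    unfolding N_def
    by (intro product_prob_spaceI prob_space.prob_space_distr prob_space_std_normal) simp
  have sets_N: "sets (N j) = sets borel" for j
    by (simp add: N_def)
  have N_lik: "emeasure (N j) B
      = (\<integral>\<^sup>+x. ennreal (exp (a j * x - (a j)\<^sup>2 / 2)) * indicator B x \<partial>std_normal_distribution)"
    if [measurable]: "B \<in> sets borel" for j and B :: "real set"
  proof -
    have "emeasure (N j) B = (\<integral>\<^sup>+x. indicator B x \<partial>N j)"
      by (simp add: sets_N)
    also have "\<dots> = (\<integral>\<^sup>+x. indicator B (x + a j) \<partial>std_normal_distribution)"
      unfolding N_def by (subst nn_integral_distr) auto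
    finally show ?thesis
      by (simp add: nn_integral_std_normal_shift)
  qed
  have sets_PiM_N: "sets (Pi\<^sub>M {1..d} N) = sets (vec_space d)"
    by (intro sets_PiM_cong) (auto simp: sets_N)
  have "distr (noise_law d) (vec_space d) (transl d a) = Pi\<^sub>M {1..d} N"
  proof (rule N.PiM_eqI)
    fix A assume "\<And>i. i \<in> {1..d} \<Longrightarrow> A i \<in> sets (N i)"
    then have A [measurable]: "A i \<in> sets borel" if "i \<in> {1..d}" for i
      using that by (simp add: sets_N)
    have "emeasure (distr (noise_law d) (vec_space d) (transl d a)) (Pi\<^sub>E {1..d} A)
        = emeasure (noise_law d) (transl d a -` Pi\<^sub>E {1..d} A \<inter> space (noise_law d))"
      by (intro emeasure_distr sets_PiM_I_finite) (auto intro: A)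
    also have "transl d a -` Pi\<^sub>E {1..d} A \<inter> space (noise_law d)
        = Pi\<^sub>E {1..d} (\<lambda>j. (\<lambda>x. x + a j) -` A j)"
      by (auto simp: transl_def space_PiM PiE_iff extensional_def)
    also have "emeasure (noise_law d) \<dots>
        = (\<Prod>j\<in>{1..d}. emeasure std_normal_distribution ((\<lambda>x. x + a j) -` A j))"
      unfolding noise_law_def 
      by (intro S.emeasure_PiM) (auto intro!: measurable_sets_borel [OF _ A])
    also have "\<dots> = (\<Prod>j\<in>{1..d}. emeasure (N j) (A j))"
      by (intro prod.cong refl) (auto simp: N_def emeasure_distr A)
    finally show "emeasure (distr (noise_law d) (vec_space d) (transl d a)) (Pi\<^sub>E {1..d} A)
        = (\<Prod>j\<in>{1..d}. emeasure (N j) (A j))" .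
  qed (auto simp: sets_PiM_N)
  also have "\<dots> = density (noise_law d) (\<lambda>\<xi>. ennreal (lik d a \<xi>))"
  proof (rule N.PiM_eqI [symmetric])
    fix A assume "\<And>i. i \<in> {1..d} \<Longrightarrow> A i \<in> sets (N i)"
    then have A [measurable]: "A i \<in> sets borel" if "i \<in> {1..d}" for i
      using that by (simp add: sets_N)
    have "emeasure (density (noise_law d) (\<lambda>\<xi>. ennreal (lik d a \<xi>))) (Pi\<^sub>E {1..d} A)
        = (\<integral>\<^sup>+\<xi>. ennreal (lik d a \<xi>) * indicator (Pi\<^sub>E {1..d} A) \<xi> \<partial>noise_law d)"
      by (intro emeasure_density) (auto intro!: sets_PiM_I_finite A)
    also have "\<dots> = (\<integral>\<^sup>+\<xi>. (\<Prod>j\<in>{1..d}. ennreal (exp (a j * \<xi> j - (a j)\<^sup>2 / 2)) * indicator (A j) (\<xi> j))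
        \<partial>noise_law d)"
    proof (intro nn_integral_cong)
      fix \<xi> assume "\<xi> \<in> space (noise_law d)"
      then have "indicator (Pi\<^sub>E {1..d} A) \<xi> = (\<Prod>j\<in>{1..d}. indicator (A j) (\<xi> j) :: ennreal)"
        by (auto simp: indicator_def space_PiM PiE_iff prod_zero_iff)
      then show "ennreal (lik d a \<xi>) * indicator (Pi\<^sub>E {1..d} A) \<xi>
          = (\<Prod>j\<in>{1..d}. ennreal (exp (a j * \<xi> j - (a j)\<^sup>2 / 2)) * indicator (A j) (\<xi> j))"
        by (simp add: lik_prod prod_ennreal prod.distrib)
    qed
    also have "\<dots> = (\<Prod>j\<in>{1..d}. emeasure (N j) (A j))"
      unfolding noise_law_def
      by (subst S.product_nn_integral_prod [where f = "\<lambda>j x. ennreal (exp (a j * x - (a j)\<^sup>2 / 2)) * indicator (A j) x"])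
        (auto simp: N_lik A)
    finally show "emeasure (density (noise_law d) (\<lambda>\<xi>. ennreal (lik d a \<xi>))) (Pi\<^sub>E {1..d} A)
        = (\<Prod>j\<in>{1..d}. emeasure (N j) (A j))" .
  qed (auto simp: sets_PiM_N)
  finally show ?thesis .
qed

lemma nn_integral_noise_shift:
  fixes g :: "(nat \<Rightarrow> real) \<Rightarrow> ennreal"
  assumes [measurable]: "g \<in> borel_measurable (vec_space d)"
  shows "(\<integral>\<^sup>+\<xi>. g (transl d a \<xi>) \<partial>noise_law d) = (\<integral>\<^sup>+\<xi>. ennreal (lik d a \<xi>) * g \<xi> \<partial>noise_law d)"
proof -
  have "(\<integral>\<^sup>+\<xi>. g (transl d a \<xi>) \<partial>noise_law d)
      = (\<integral>\<^sup>+\<xi>. g \<xi> \<partial>distr (noise_law d) (vec_space d) (transl d a))"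
    by (subst nn_integral_distr) auto
  also have "\<dots> = (\<integral>\<^sup>+\<xi>. ennreal (lik d a \<xi>) * g \<xi> \<partial>noise_law d)"
    unfolding distr_noise_law_shift by (subst nn_integral_density) auto
  finally show ?thesis .
qed

lemma nn_integral_lik: "(\<integral>\<^sup>+\<xi>. ennreal (lik d a \<xi>) \<partial>noise_law d) = 1"
  using nn_integral_noise_shift [of "\<lambda>_. 1" d a] prob_space.emeasure_space_1 [OF prob_space_noise_law, of d]
  by simp

text \<open>The linear parts of the exponents add up, whereas the square of \<open>a j + b j\<close>
  exceeds the sum of the squares by a cross term. Since every \<open>lik\<close> has integral 1,
  this makes mixed second moments explicit.\<close>

lemma lik_mult: "lik d a \<xi> * lik d b \<xi> = exp (\<Sum>j=1..d. a j * b j) * lik d (\<lambda>j. a j + b j) \<xi>"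
  by (simp add: lik_def exp_add [symmetric] power2_sum sum.distrib add_divide_distrib
      ring_distribs mult.assoc sum_distrib_left [symmetric])

lemma nn_integral_lik_mult:
  "(\<integral>\<^sup>+\<xi>. ennreal (lik d a \<xi> * lik d b \<xi>) \<partial>noise_law d) = ennreal (exp (\<Sum>j=1..d. a j * b j))"
  by (simp add: lik_mult ennreal_mult lik_pos less_imp_le nn_integral_cmult nn_integral_lik)

section \<open>From a second moment of likelihood ratios to a risk bound\<close>

lemma risk_eq_noise:
  assumes T: "T \<in> estimators d" and "\<sigma> > 0"
  shows "risk d \<sigma> T \<theta> = (\<integral>\<^sup>+\<xi>. ennreal (lik d (\<lambda>j. (\<theta> j - \<eta> j) / \<sigma>) \<xi>) *
    ennreal ((T (\<lambda>j\<in>{1..d}. \<eta> j + \<sigma> * \<xi> j) - Q d \<theta>)\<^sup>2) \<partial>noise_law d)"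
proof -
  have [measurable]: "T \<in> borel_measurable (vec_space d)"
    using T by (simp add: estimators_def)
  \<comment> \<open>An observation at \<theta> is one at \<eta> whose noise is translated by
    (\<theta> - \<eta>) / \<sigma>; so all risks become integrals of the same function family
    against one law.\<close>
  have *: "(\<lambda>j\<in>{1..d}. \<eta> j + \<sigma> * transl d (\<lambda>j. (\<theta> j - \<eta> j) / \<sigma>) \<xi> j)
      = (\<lambda>j\<in>{1..d}. \<theta> j + \<sigma> * \<xi> j)" for \<xi>
    using \<open>\<sigma> > 0\<close> by (auto simp: transl_def restrict_def field_simps)
  have "risk d \<sigma> T \<theta>
      = (\<integral>\<^sup>+\<xi>. ennreal ((T (\<lambda>j\<in>{1..d}. \<theta> j + \<sigma> * \<xi> j) - Q d \<theta>)\<^sup>2) \<partial>noise_law d)"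
    unfolding risk_def obs_law_def by (subst nn_integral_distr) auto
  also have "\<dots> = (\<integral>\<^sup>+\<xi>. ennreal ((T (\<lambda>j\<in>{1..d}. \<eta> j + \<sigma> *
      transl d (\<lambda>j. (\<theta> j - \<eta> j) / \<sigma>) \<xi> j) - Q d \<theta>)\<^sup>2) \<partial>noise_law d)"
    by (simp only: *)
  also have "\<dots> = (\<integral>\<^sup>+\<xi>. ennreal (lik d (\<lambda>j. (\<theta> j - \<eta> j) / \<sigma>) \<xi>) *
    ennreal ((T (\<lambda>j\<in>{1..d}. \<eta> j + \<sigma> * \<xi> j) - Q d \<theta>)\<^sup>2) \<partial>noise_law d)"
    by (rule nn_integral_noise_shift) measurable
  finally show ?thesis .
qed

text \<open>Here \<open>w\<close> is the error at the base point and \<open>w - \<delta>\<close> the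
  error at an alternative. The minimum over \<open>w\<close> of the first two terms is \<delta>^2 f
  / (1 + f), attained at w = f \<delta> / (1 + f). The parameter \<open>t\<close> bounds f / (1 + f)
  below by a polynomial in f, so that only the first two moments of f matter after
  integration.\<close>

lemma testing_inequality:
  fixes w f t \<delta> :: real
  assumes "f \<ge> 0"
  shows "2 * t * \<delta>\<^sup>2 * f \<le> w\<^sup>2 + f * (w - \<delta>)\<^sup>2 + t\<^sup>2 * \<delta>\<^sup>2 * (f + f\<^sup>2)"
proof -
  have "w\<^sup>2 + f * (w - \<delta>)\<^sup>2 + t\<^sup>2 * \<delta>\<^sup>2 * (f + f\<^sup>2) - 2 * t * \<delta>\<^sup>2 * f
      = (((1 + f) * w - f * \<delta>)\<^sup>2 + f * (\<delta> - t * \<delta> * (1 + f))\<^sup>2) / (1 + f)"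
    using assms by (simp add: field_simps power2_eq_square)
  also have "\<dots> \<ge> 0"
    using assms by simp
  finally show ?thesis
    by simp
qed

text \<open>Integrate \<open>testing_inequality\<close> with w = U - q0. As f has mean 1, the left
  side gives 2 t \<delta>^2; the right side is at most 2 R + t^2 \<delta>^2 (1 + C), where
  \<open>chi2\<close> bounds the second moment of f.\<close>

lemma max_risk_ge:
  fixes \<theta> :: "'i \<Rightarrow> nat \<Rightarrow> real" and R :: ennreal
  assumes T: "T \<in> estimators d" and "\<sigma> > 0" and fin: "finite I" "I \<noteq> {}" and "C \<ge> 0"
    and Q0: "Q d \<eta> = q0" and Q1: "\<And>i. i \<in> I \<Longrightarrow> Q d (\<theta> i) = q1"
    and chi2: "(\<Sum>i\<in>I. \<Sum>k\<in>I. exp (\<Sum>j=1..d. (\<theta> i j - \<eta> j) * (\<theta> k j - \<eta> j) / \<sigma>\<^sup>2))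
      \<le> C * (real (card I))\<^sup>2"
    and R0: "risk d \<sigma> T \<eta> \<le> R" and R1: "\<And>i. i \<in> I \<Longrightarrow> risk d \<sigma> T (\<theta> i) \<le> R"
  shows "ennreal ((q1 - q0)\<^sup>2 / (2 * (1 + C))) \<le> R"
\<comment> \<open>An infinite bound is trivial; a finite one allows the closing subtraction to be
  done in the reals.\<close>
proof (cases "R = \<infinity>")
  case False
  have [measurable]: "T \<in> borel_measurable (vec_space d)"
    using T by (simp add: estimators_def)
  define N where "N = real (card I)"
  define U where "U \<xi> = T (\<lambda>j\<in>{1..d}. \<eta> j + \<sigma> * \<xi> j)" for \<xi>
  define L where "L i = lik d (\<lambda>j. (\<theta> i j - \<eta> j) / \<sigma>)" for i
  define f where "f \<xi> = (\<Sum>i\<in>I. L i \<xi>) / N" for \<xi>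
  define \<delta> where "\<delta> = q1 - q0"
  \<comment> \<open>Maximises 2 t - t^2 (1 + C), the factor of \<delta>^2 that remains after
    integration.\<close>
  define t where "t = 1 / (1 + C)"
  have N: "N > 0"
    using fin by (simp add: N_def card_gt_0_iff)
  have [measurable]: "L i \<in> borel_measurable (vec_space d)" for i
    unfolding L_def by measurable
  have [measurable]: "f \<in> borel_measurable (vec_space d)" "U \<in> borel_measurable (vec_space d)"
    unfolding f_def U_def by measurable
  have L: "L i \<xi> \<ge> 0" for i \<xi>
    by (simp add: L_def lik_pos less_imp_le)
  have f: "f \<xi> \<ge> 0" for \<xi>
    using N by (simp add: f_def L sum_nonneg)
  have avg: "(\<integral>\<^sup>+\<xi>. ennreal (f \<xi>) * g \<xi> \<partial>noise_law d)
      = ennreal (1 / N) * (\<Sum>i\<in>I. \<integral>\<^sup>+\<xi>. ennreal (L i \<xi>) * g \<xi> \<partial>noise_law d)"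
    if [measurable]: "g \<in> borel_measurable (vec_space d)" for g
  proof -
    have "ennreal (f \<xi>) = ennreal (1 / N) * (\<Sum>i\<in>I. ennreal (L i \<xi>))" for \<xi>
      using N by (simp add: f_def L ennreal_mult [symmetric] sum_nonneg)
    then have "(\<integral>\<^sup>+\<xi>. ennreal (f \<xi>) * g \<xi> \<partial>noise_law d)
        = (\<integral>\<^sup>+\<xi>. ennreal (1 / N) * (\<Sum>i\<in>I. ennreal (L i \<xi>) * g \<xi>) \<partial>noise_law d)"
      by (simp add: mult.assoc sum_distrib_right)
    also have "\<dots> = ennreal (1 / N) * (\<Sum>i\<in>I. \<integral>\<^sup>+\<xi>. ennreal (L i \<xi>) * g \<xi> \<partial>noise_law d)"
      by (simp add: nn_integral_cmult nn_integral_sum)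
    finally show ?thesis .
  qed
  have normalize: "ennreal (1 / N) * (of_nat (card I) * x) = x" for x
    using N by (simp add: N_def ennreal_of_nat_eq_real_of_nat mult.assoc [symmetric]
        ennreal_mult [symmetric])
  have f_1: "(\<integral>\<^sup>+\<xi>. ennreal (f \<xi>) \<partial>noise_law d) = 1"
    using avg [of "\<lambda>_. 1"] normalize [of 1] by (simp add: L_def nn_integral_lik)
  have "(\<integral>\<^sup>+\<xi>. ennreal (L i \<xi>) * ennreal (f \<xi>) \<partial>noise_law d)
      = ennreal (1 / N) * ennreal (\<Sum>k\<in>I. exp (\<Sum>j=1..d. (\<theta> i j - \<eta> j) * (\<theta> k j - \<eta> j) / \<sigma>\<^sup>2))" for i
    using avg [of "\<lambda>\<xi>. ennreal (L i \<xi>)"]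
    by (simp add: L_def nn_integral_lik_mult ennreal_mult [symmetric] lik_pos less_imp_le mult.commute
        power2_eq_square)
  then have "(\<integral>\<^sup>+\<xi>. ennreal (f \<xi>) * ennreal (f \<xi>) \<partial>noise_law d)
      = ennreal (1 / N) * (\<Sum>i\<in>I. ennreal (1 / N) *
        ennreal (\<Sum>k\<in>I. exp (\<Sum>j=1..d. (\<theta> i j - \<eta> j) * (\<theta> k j - \<eta> j) / \<sigma>\<^sup>2)))"
    by (subst avg) simp_all
  also have "\<dots> = ennreal (1 / N * (1 / N) *
      (\<Sum>i\<in>I. \<Sum>k\<in>I. exp (\<Sum>j=1..d. (\<theta> i j - \<eta> j) * (\<theta> k j - \<eta> j) / \<sigma>\<^sup>2)))"
    using N by (simp add: ennreal_mult [symmetric] sum_nonneg sum_divide_distrib)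
  also have "\<dots> \<le> ennreal C"
    using chi2 N by (intro ennreal_leI) (simp add: N_def field_simps power2_eq_square)
  finally have f_2: "(\<integral>\<^sup>+\<xi>. ennreal (f \<xi>) * ennreal (f \<xi>) \<partial>noise_law d) \<le> ennreal C" .
  \<comment> \<open>With \<theta> = \<eta> the ratio is 1, so \<open>risk_eq_noise\<close> also
    covers the base risk.\<close>
  have "lik d (\<lambda>j. (\<eta> j - \<eta> j) / \<sigma>) \<xi> = 1" for \<xi>
    by (simp add: lik_def)
  then have U0: "(\<integral>\<^sup>+\<xi>. ennreal ((U \<xi> - q0)\<^sup>2) \<partial>noise_law d) \<le> R"
    using R0 by (simp add: risk_eq_noise [OF T \<open>\<sigma> > 0\<close>, of \<eta> \<eta>] Q0 U_def)
  have "(\<integral>\<^sup>+\<xi>. ennreal (f \<xi>) * ennreal ((U \<xi> - q1)\<^sup>2) \<partial>noise_law d)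
      = ennreal (1 / N) * (\<Sum>i\<in>I. risk d \<sigma> T (\<theta> i))"
    by (subst avg) (auto simp: risk_eq_noise [OF T \<open>\<sigma> > 0\<close>, of _ \<eta>] Q1 U_def L_def intro!: sum.cong)
  also have "\<dots> \<le> ennreal (1 / N) * (of_nat (card I) * R)"
    by (intro mult_left_mono sum_bounded_above R1) auto
  finally have U1: "(\<integral>\<^sup>+\<xi>. ennreal (f \<xi>) * ennreal ((U \<xi> - q1)\<^sup>2) \<partial>noise_law d) \<le> R"
    by (simp add: normalize)
  have "ennreal (2 * t * \<delta>\<^sup>2) = (\<integral>\<^sup>+\<xi>. ennreal (2 * t * \<delta>\<^sup>2) * ennreal (f \<xi>) \<partial>noise_law d)"
    by (simp add: nn_integral_cmult f_1)
  also have "\<dots> \<le> (\<integral>\<^sup>+\<xi>. (ennreal ((U \<xi> - q0)\<^sup>2) + ennreal (f \<xi>) * ennreal ((U \<xi> - q1)\<^sup>2)) +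
      ennreal (t\<^sup>2 * \<delta>\<^sup>2) * (ennreal (f \<xi>) + ennreal (f \<xi>) * ennreal (f \<xi>)) \<partial>noise_law d)"
  proof (intro nn_integral_mono)
    fix \<xi>
    have "2 * t * \<delta>\<^sup>2 * f \<xi> \<le> (U \<xi> - q0)\<^sup>2 + f \<xi> * (U \<xi> - q1)\<^sup>2 + t\<^sup>2 * \<delta>\<^sup>2 * (f \<xi> + f \<xi> * f \<xi>)"
      using testing_inequality [OF f, of t \<delta> \<xi> "U \<xi> - q0"] by (simp add: \<delta>_def power2_eq_square)
    then show "ennreal (2 * t * \<delta>\<^sup>2) * ennreal (f \<xi>) \<le>
      (ennreal ((U \<xi> - q0)\<^sup>2) + ennreal (f \<xi>) * ennreal ((U \<xi> - q1)\<^sup>2)) +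
      ennreal (t\<^sup>2 * \<delta>\<^sup>2) * (ennreal (f \<xi>) + ennreal (f \<xi>) * ennreal (f \<xi>))"
      using \<open>C \<ge> 0\<close> f by (simp add: t_def ennreal_mult [symmetric] ennreal_plus [symmetric] del: ennreal_plus)
  qed
  also have "\<dots> \<le> (R + R) + ennreal (t\<^sup>2 * \<delta>\<^sup>2) * (1 + ennreal C)"
    by (simp add: nn_integral_add nn_integral_cmult f_1) (intro add_mono mult_left_mono U0 U1 f_2; simp)
  finally have "ennreal (2 * t * \<delta>\<^sup>2) \<le> (R + R) + ennreal (t\<^sup>2 * \<delta>\<^sup>2) * (1 + ennreal C)" .
  moreover obtain r where r: "r \<ge> 0" "R = ennreal r"
    using False by (cases R) auto
  moreover have "ennreal (t\<^sup>2 * \<delta>\<^sup>2) * (1 + ennreal C) = ennreal (t * \<delta>\<^sup>2)"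
    using \<open>C \<ge> 0\<close> by (simp add: t_def ennreal_mult [symmetric] ennreal_plus [symmetric] power2_eq_square
        ennreal_1 [symmetric] del: ennreal_plus ennreal_1)
  moreover have "t \<ge> 0"
    using \<open>C \<ge> 0\<close> by (simp add: t_def)
  ultimately have "2 * t * \<delta>\<^sup>2 \<le> r + r + t * \<delta>\<^sup>2"
    by (simp add: ennreal_plus [symmetric] del: ennreal_plus)
  then have "t * \<delta>\<^sup>2 / 2 \<le> r"
    by simp
  then show ?thesis
    by (simp add: r \<delta>_def t_def mult.commute)
qed simp

lemma minimax_risk_ge:
  fixes \<theta> :: "'i \<Rightarrow> nat \<Rightarrow> real"
  assumes "\<sigma> > 0" "finite I" "I \<noteq> {}" "C \<ge> 0"
    and "\<eta> \<in> \<Theta>" "\<And>i. i \<in> I \<Longrightarrow> \<theta> i \<in> \<Theta>"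
    and "\<And>i. i \<in> I \<Longrightarrow> Q d (\<theta> i) = q1"
    and "(\<Sum>i\<in>I. \<Sum>k\<in>I. exp (\<Sum>j=1..d. (\<theta> i j - \<eta> j) * (\<theta> k j - \<eta> j) / \<sigma>\<^sup>2))
      \<le> C * (real (card I))\<^sup>2"
  shows "ennreal ((q1 - Q d \<eta>)\<^sup>2 / (2 * (1 + C)))
    \<le> (INF T\<in>estimators d. SUP \<theta>\<in>\<Theta>. risk d \<sigma> T \<theta>)"
  by (intro INF_greatest max_risk_ge [where \<theta> = \<theta> and \<sigma> = \<sigma> and I = I and \<eta> = \<eta>])
     (use assms in \<open>auto intro: SUP_upper\<close>)

section \<open>Spike vectors and the two-point bound\<close>

abbreviation minimax_risk :: "nat \<Rightarrow> nat \<Rightarrow> real \<Rightarrow> real \<Rightarrow> ennreal" where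
  "minimax_risk s d \<kappa> \<sigma> \<equiv> INF T\<in>estimators d. SUP \<theta>\<in>B2 d \<kappa> \<inter> B0 d s. risk d \<sigma> T \<theta>"

definition spike :: "nat \<Rightarrow> nat set \<Rightarrow> real \<Rightarrow> nat \<Rightarrow> real" where
  "spike d S \<rho> = (\<lambda>j\<in>{1..d}. if j \<in> S then \<rho> else 0)"

lemma sum_spike_mult:
  assumes "S \<subseteq> {1..d}"
  shows "(\<Sum>j=1..d. spike d S \<rho> j * spike d S' \<rho>' j) = real (card (S \<inter> S')) * (\<rho> * \<rho>')"
proof -
  have "(\<Sum>j=1..d. spike d S \<rho> j * spike d S' \<rho>' j)
      = (\<Sum>j\<in>{1..d}. if j \<in> S \<inter> S' then \<rho> * \<rho>' else 0)"
    by (intro sum.cong) (auto simp: spike_def)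
  also have "\<dots> = (\<Sum>j\<in>S \<inter> S'. \<rho> * \<rho>')"
    using assms by (intro sum.mono_neutral_cong_right) auto
  finally show ?thesis
    by simp
qed

lemma Q_spike: "S \<subseteq> {1..d} \<Longrightarrow> Q d (spike d S \<rho>) = real (card S) * \<rho>\<^sup>2"
  using sum_spike_mult [of S d \<rho> S \<rho>] by (simp add: Q_def power2_eq_square)

lemma spike_in_B:
  assumes "S \<subseteq> {1..d}" "card S \<le> s" "real (card S) * \<rho>\<^sup>2 \<le> \<kappa>\<^sup>2" "\<kappa> \<ge> 0"
  shows "spike d S \<rho> \<in> B2 d \<kappa> \<inter> B0 d s"
proof -
  \<comment> \<open>Only an inequality: for \<rho> = 0 the support is empty.\<close>
  have "card {i \<in> {1..d}. spike d S \<rho> i \<noteq> 0} \<le> card S"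
    using assms(1) by (intro card_mono finite_subset [OF assms(1)]) (auto simp: spike_def split: if_splits)
  moreover have "spike d S \<rho> \<in> space (vec_space d)"
    by (simp add: spike_def space_PiM)
  ultimately show ?thesis
    using assms by (simp add: B2_def B0_def norm0_def norm2_def Q_spike real_le_lsqrt)
qed

text \<open>The points have first coordinate \<kappa> and \<kappa> - h, all others 0. Since h \<le>
  \<sigma>, the second moment is at most exp 1 \<le> 3, so C = 3 and 1/8 = 1 / (2 (1 + C)). The
  functionals differ by h (2 \<kappa> - h) \<ge> h \<kappa>.\<close>

lemma minimax_risk_ge_two_points:
  assumes "1 \<le> s" "s \<le> d" "\<kappa> > 0" "\<sigma> > 0"
  shows "ennreal (1 / 8 * min (\<kappa> ^ 4) (\<sigma>\<^sup>2 * \<kappa>\<^sup>2)) \<le> minimax_risk s d \<kappa> \<sigma>"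
proof -
  define h where "h = min \<kappa> \<sigma>"
  have h: "0 < h" "h \<le> \<kappa>" "h \<le> \<sigma>"
    using assms by (auto simp: h_def)
  have diff: "spike d {1} \<kappa> j - spike d {1} (\<kappa> - h) j = spike d {1} h j" if "j \<in> {1..d}" for j
    using that by (simp add: spike_def)
  have "(\<Sum>j=1..d. (spike d {1} \<kappa> j - spike d {1} (\<kappa> - h) j) * (spike d {1} \<kappa> j - spike d {1} (\<kappa> - h) j) / \<sigma>\<^sup>2)
      = (\<Sum>j=1..d. spike d {1} h j * spike d {1} h j / \<sigma>\<^sup>2)"
    by (intro sum.cong) (auto simp: diff)
  also have "\<dots> = h\<^sup>2 / \<sigma>\<^sup>2"
    using assms sum_spike_mult [of "{1}" d h "{1}" h]
    by (simp add: sum_divide_distrib [symmetric] power2_eq_square)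
  also have "\<dots> \<le> 1"
    using h assms by (simp add: power_mono)
  finally have "exp (\<Sum>j=1..d. (spike d {1} \<kappa> j - spike d {1} (\<kappa> - h) j) *
      (spike d {1} \<kappa> j - spike d {1} (\<kappa> - h) j) / \<sigma>\<^sup>2) \<le> exp 1"
    by simp
  also have "exp 1 \<le> (3 :: real)"
    by (rule exp_le)
  finally have chi2: "exp (\<Sum>j=1..d. (spike d {1} \<kappa> j - spike d {1} (\<kappa> - h) j) *
      (spike d {1} \<kappa> j - spike d {1} (\<kappa> - h) j) / \<sigma>\<^sup>2) \<le> 3" .
  have in_B: "spike d {1} x \<in> B2 d \<kappa> \<inter> B0 d s" if "0 \<le> x" "x \<le> \<kappa>" for x
    using assms that by (intro spike_in_B) (auto simp: power_mono)
  have *: "ennreal ((\<kappa>\<^sup>2 - Q d (spike d {1} (\<kappa> - h)))\<^sup>2 / (2 * (1 + 3))) \<le> minimax_risk s d \<kappa> \<sigma>"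
    using assms h chi2 in_B
    by (intro minimax_risk_ge [where I = "{()}" and \<theta> = "\<lambda>_. spike d {1} \<kappa>"]) (auto simp: Q_spike)
  have "Q d (spike d {1} (\<kappa> - h)) = (\<kappa> - h)\<^sup>2"
    using assms by (simp add: Q_spike)
  then have "(\<kappa>\<^sup>2 - Q d (spike d {1} (\<kappa> - h))) = h * \<kappa> + h * (\<kappa> - h)"
    by (simp add: power2_eq_square algebra_simps)
  moreover have "h * \<kappa> + h * (\<kappa> - h) \<ge> h * \<kappa>"
    using h by simp
  ultimately have "(h * \<kappa>)\<^sup>2 \<le> (\<kappa>\<^sup>2 - Q d (spike d {1} (\<kappa> - h)))\<^sup>2"
    using h by (intro power_mono) auto
  moreover have "(h * \<kappa>)\<^sup>2 \<ge> min (\<kappa> ^ 4) (\<sigma>\<^sup>2 * \<kappa>\<^sup>2)"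
    by (cases "\<kappa> \<le> \<sigma>") (simp_all add: h_def power2_eq_square power4_eq_xxxx min_le_iff_disj ac_simps)
  ultimately show ?thesis
    by (intro order_trans [OF ennreal_leI *]) simp
qed

section \<open>The mixture of blockwise spikes\<close>

lemma sum_exp_agreements:
  fixes r :: real
  assumes "m \<ge> 1" "s \<ge> 1" "exp r - 1 \<le> real m / real s"
    "\<phi> \<in> {..<s} \<rightarrow>\<^sub>E {..<m}"
  shows "(\<Sum>\<psi>\<in>{..<s} \<rightarrow>\<^sub>E {..<m}. exp (real (card {k\<in>{..<s}. \<phi> k = \<psi> k}) * r)) \<le> 3 * real m ^ s"
proof -
  have "exp (real (card {k\<in>{..<s}. \<phi> k = \<psi> k}) * r)
      = (\<Prod>k\<in>{..<s}. if \<phi> k = \<psi> k then exp r else 1)" for \<psi>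
    by (simp add: prod.If_cases exp_of_nat_mult Int_def)
  \<comment> \<open>The blocks are chosen independently, so the sum over choice functions
    factorises; in each factor exactly one of the \<open>m\<close> choices agrees with
    \<open>\<phi> k\<close>.\<close>
  then have "(\<Sum>\<psi>\<in>{..<s} \<rightarrow>\<^sub>E {..<m}. exp (real (card {k\<in>{..<s}. \<phi> k = \<psi> k}) * r))
      = (\<Prod>k\<in>{..<s}. \<Sum>i\<in>{..<m}. if \<phi> k = i then exp r else 1)"
    by (subst prod_sum_PiE) auto
  also have "\<dots> = (\<Prod>k\<in>{..<s}. real m + (exp r - 1))"
  proof (intro prod.cong refl)
    fix k assume "k \<in> {..<s}"
    then have "\<phi> k \<in> {..<m}"
      using assms(4) by auto
    then have "(\<Sum>i\<in>{..<m}. if \<phi> k = i then exp r - 1 else 0) = exp r - 1"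
      by (subst sum.delta') auto
    moreover have "(\<Sum>i\<in>{..<m}. if \<phi> k = i then exp r else 1)
        = (\<Sum>i\<in>{..<m}. 1 + (if \<phi> k = i then exp r - 1 else 0))"
      by (intro sum.cong) auto
    ultimately show "(\<Sum>i\<in>{..<m}. if \<phi> k = i then exp r else 1) = real m + (exp r - 1)"
      by (simp add: sum.distrib)
  qed
  also have "\<dots> = (real m + (exp r - 1)) ^ s"
    by simp
  \<comment> \<open>Each factor is at most m (1 + 1/s), and (1 + 1/s)^s \<le> exp 1 \<le> 3.\<close>
  also have "\<dots> \<le> (real m * (1 + 1 / real s)) ^ s"
  proof (intro power_mono)
    show "real m + (exp r - 1) \<le> real m * (1 + 1 / real s)"
      using assms by (simp add: algebra_simps)
    have "real m + (exp r - 1) \<ge> (real m - 1) + exp r"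
      by simp
    then show "0 \<le> real m + (exp r - 1)"
      using assms exp_gt_zero [of r] by linarith
  qed
  also have "\<dots> \<le> (real m * exp (1 / real s)) ^ s"
    by (intro power_mono mult_left_mono exp_ge_add_one_self) auto
  also have "\<dots> = real m ^ s * exp 1"
    using assms by (simp add: power_mult_distrib exp_of_nat_mult [symmetric])
  also have "\<dots> \<le> real m ^ s * 3"
    by (intro mult_left_mono exp_le) auto
  finally show ?thesis
    by simp
qed

text \<open>The construction uses sparsity \<open>s\<close>, the parameter set the possibly larger
  \<open>s'\<close>; in the dense regime the best construction is sparser than allowed. The factor 2
  inside the logarithm pays for rounding \<open>d / s\<close> down.\<close>

lemma minimax_risk_ge_mixture:
  assumes "1 \<le> s" "s \<le> s'" "s \<le> d" "\<kappa> > 0" "\<sigma> > 0"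
  shows "ennreal (1 / 8 * (min (\<kappa>\<^sup>2) (\<sigma>\<^sup>2 * real s * ln (1 + real d / (2 * (real s)\<^sup>2))))\<^sup>2)
    \<le> minimax_risk s' d \<kappa> \<sigma>"
proof -
  define m where "m = d div s"
  define q where "q = min (\<kappa>\<^sup>2) (\<sigma>\<^sup>2 * real s * ln (1 + real d / (2 * (real s)\<^sup>2)))"
  \<comment> \<open>Gives every alternative the functional value s \<rho>^2 = q.\<close>
  define \<rho> where "\<rho> = sqrt (q / s)"
  \<comment> \<open>Block k consists of the coordinates k m + 1, ..., k m + m; the shift by 1 is due
    to indices starting at 1.\<close>
  define S where "S \<phi> = (\<lambda>k. k * m + \<phi> k + 1) ` {..<s}" for \<phi>
  define I where "I = {..<s} \<rightarrow>\<^sub>E {..<m}"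
  have "m > 0"
    using assms by (simp add: m_def div_greater_zero_iff)
  then have m: "m \<ge> 1" "s * m \<le> d"
    by (auto simp: m_def)
  have "d < s * m + s"
    using assms mult_div_mod_eq [of s d] mod_less_divisor [of s d] unfolding m_def by linarith
  also have "s * m + s \<le> 2 * (s * m)"
    using m by simp
  finally have "real d \<le> real (2 * (s * m))"
    by linarith
  then have dm: "real d \<le> 2 * (real s * real m)"
    by simp
  have "q \<ge> 0"
    using assms by (simp add: q_def)
  then have \<rho>: "real s * \<rho>\<^sup>2 = q"
    using assms by (simp add: \<rho>_def)
  \<comment> \<open>Uniqueness of division with remainder: the blocks are disjoint, so two supports
    meet exactly in the blocks where the choice functions agree.\<close>
  have block: "(k * m + i = k' * m + i') = (k = k' \<and> i = i')" if "i < m" "i' < m" for k k' i i'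
  proof
    assume *: "k * m + i = k' * m + i'"
    then have "(k * m + i) div m = (k' * m + i') div m"
      by simp
    with that have "k = k'"
      by (simp add: div_mult_self3)
    with * show "k = k' \<and> i = i'"
      by simp
  qed simp
  have I: "\<phi> k < m" if "\<phi> \<in> I" "k < s" for \<phi> k
    using that by (auto simp: I_def)
  have card_I: "card I = m ^ s"
    by (simp add: I_def card_PiE)
  have inj: "inj_on (\<lambda>k. k * m + \<phi> k + 1) {..<s}" if "\<phi> \<in> I" for \<phi>
    using that by (auto simp: inj_on_def block I)
  have card_S: "card (S \<phi>) = s" if "\<phi> \<in> I" for \<phi>
    using inj [OF that] by (simp add: S_def card_image)
  have S_sub: "S \<phi> \<subseteq> {1..d}" if "\<phi> \<in> I" for \<phi>
  proof
    fix j assume "j \<in> S \<phi>"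
    then obtain k where k: "k < s" "j = k * m + \<phi> k + 1"
      by (auto simp: S_def)
    have "j \<le> k * m + m"
      using k I [OF that k(1)] by simp
    also have "\<dots> = Suc k * m"
      by simp
    also have "\<dots> \<le> s * m"
      using k by (intro mult_right_mono) auto
    finally show "j \<in> {1..d}"
      using k m by simp
  qed
  have card_S_Int: "card (S \<phi> \<inter> S \<psi>) = card {k\<in>{..<s}. \<phi> k = \<psi> k}" if "\<phi> \<in> I" "\<psi> \<in> I" for \<phi> \<psi>
  proof -
    have "S \<phi> \<inter> S \<psi> = (\<lambda>k. k * m + \<phi> k + 1) ` {k\<in>{..<s}. \<phi> k = \<psi> k}"
      using that by (auto simp: S_def block I image_iff)
    moreover have "inj_on (\<lambda>k. k * m + \<phi> k + 1) {k\<in>{..<s}. \<phi> k = \<psi> k}"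
      by (rule inj_on_subset [OF inj [OF that(1)]]) auto
    ultimately show ?thesis
      by (simp only: card_image)
  qed
  \<comment> \<open>The contribution of one shared coordinate to the exponent. The cap in
    \<open>q\<close> gives exp r - 1 \<le> d / (2 s^2), and \<open>dm\<close> turns this into m /
    s.\<close>
  define r where "r = \<rho>\<^sup>2 / \<sigma>\<^sup>2"
  have "real s * \<rho>\<^sup>2 \<le> \<sigma>\<^sup>2 * real s * ln (1 + real d / (2 * (real s)\<^sup>2))"
    by (simp add: \<rho> q_def)
  then have "r \<le> ln (1 + real d / (2 * (real s)\<^sup>2))"
    using assms by (simp add: r_def field_simps)
  then have "exp r \<le> exp (ln (1 + real d / (2 * (real s)\<^sup>2)))"
    by simp
  also have "\<dots> = 1 + real d / (2 * (real s)\<^sup>2)"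
    by (intro exp_ln) (simp add: add_pos_nonneg)
  finally have "exp r - 1 \<le> real d / (2 * (real s)\<^sup>2)"
    by simp
  also have "\<dots> \<le> 2 * (real s * real m) / (2 * (real s)\<^sup>2)"
    by (intro divide_right_mono dm) auto
  also have "\<dots> = real m / real s"
    using assms by (simp add: power2_eq_square)
  finally have r: "exp r - 1 \<le> real m / real s" .
  have "(\<Sum>j=1..d. (spike d (S \<phi>) \<rho> j - spike d {} 0 j) * (spike d (S \<psi>) \<rho> j - spike d {} 0 j) / \<sigma>\<^sup>2)
      = real (card {k\<in>{..<s}. \<phi> k = \<psi> k}) * r" if "\<phi> \<in> I" "\<psi> \<in> I" for \<phi> \<psi>
  proof -
    have "(\<Sum>j=1..d. (spike d (S \<phi>) \<rho> j - spike d {} 0 j) * (spike d (S \<psi>) \<rho> j - spike d {} 0 j) / \<sigma>\<^sup>2)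
        = (\<Sum>j=1..d. spike d (S \<phi>) \<rho> j * spike d (S \<psi>) \<rho> j) / \<sigma>\<^sup>2"
      unfolding sum_divide_distrib by (intro sum.cong) (auto simp: spike_def [of d "{}"])
    then show ?thesis
      using that by (simp add: sum_spike_mult S_sub card_S_Int r_def power2_eq_square)
  qed
  then have "(\<Sum>\<phi>\<in>I. \<Sum>\<psi>\<in>I. exp (\<Sum>j=1..d. (spike d (S \<phi>) \<rho> j - spike d {} 0 j) *
      (spike d (S \<psi>) \<rho> j - spike d {} 0 j) / \<sigma>\<^sup>2))
      = (\<Sum>\<phi>\<in>I. \<Sum>\<psi>\<in>I. exp (real (card {k\<in>{..<s}. \<phi> k = \<psi> k}) * r))"
    by (intro sum.cong) auto
  also have "\<dots> \<le> (\<Sum>\<phi>\<in>I. 3 * real m ^ s)"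
    unfolding I_def by (intro sum_mono sum_exp_agreements m assms r)
  also have "\<dots> = 3 * (real (card I))\<^sup>2"
    by (simp add: card_I power2_eq_square)
  finally have chi2: "(\<Sum>\<phi>\<in>I. \<Sum>\<psi>\<in>I. exp (\<Sum>j=1..d. (spike d (S \<phi>) \<rho> j - spike d {} 0 j) *
      (spike d (S \<psi>) \<rho> j - spike d {} 0 j) / \<sigma>\<^sup>2)) \<le> 3 * (real (card I))\<^sup>2" .
  have "finite I"
    by (auto simp: I_def intro!: finite_PiE)
  moreover have "I \<noteq> {}"
    using card_I m by force
  moreover have "q \<le> \<kappa>\<^sup>2"
    by (simp add: q_def)
  ultimately have "ennreal ((q - Q d (spike d {} 0))\<^sup>2 / (2 * (1 + 3))) \<le> minimax_risk s' d \<kappa> \<sigma>"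
    using assms chi2
    by (intro minimax_risk_ge [where I = I and \<theta> = "\<lambda>\<phi>. spike d (S \<phi>) \<rho>"] spike_in_B)
       (auto simp: Q_spike S_sub card_S \<rho>)
  then show ?thesis
    by (simp add: Q_spike q_def)
qed

section \<open>Comparison with \<open>psi_bar\<close> and conclusion\<close>

lemma min_power2_eq:
  fixes a b :: real
  assumes "a \<ge> 0" "b \<ge> 0"
  shows "(min a b)\<^sup>2 = min (a\<^sup>2) (b\<^sup>2)"
  using assms by (cases a b rule: linorder_le_cases) (simp_all add: min_absorb1 min_absorb2 power_mono)

text \<open>Because (1 + x/2)^2 \<ge> 1 + x. It removes the factor 2 inside the logarithm of the
  mixture bound.\<close>

lemma ln_one_plus_half_ge:
  fixes x :: real
  assumes "x \<ge> 0"
  shows "ln (1 + x / 2) \<ge> ln (1 + x) / 2"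
proof -
  have "ln (1 + x) \<le> ln ((1 + x / 2)\<^sup>2)"
    using assms by (intro ln_mono) (auto simp: power2_eq_square algebra_simps add_pos_nonneg)
  then show ?thesis
    using assms by (simp add: ln_realpow)
qed

lemma minimax_risk_ge_sparse:
  assumes "1 \<le> s" "s \<le> d" "\<kappa> > 0" "\<sigma> > 0"
  shows "ennreal (1 / 288 * min (\<kappa> ^ 4) (psi_bar \<sigma> s d)) \<le> minimax_risk s d \<kappa> \<sigma>"
proof -
  have *: "ennreal (1 / 8 * min (\<kappa> ^ 4) (\<sigma> ^ 4 * (real k)\<^sup>2 * (ln (1 + real d / (2 * (real k)\<^sup>2)))\<^sup>2))
      \<le> minimax_risk s d \<kappa> \<sigma>" if "1 \<le> k" "k \<le> s" for k
    using minimax_risk_ge_mixture [of k s d \<kappa> \<sigma>] assms that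
    by (subst (asm) min_power2_eq) (simp_all add: power_mult_distrib power_mult [symmetric])
  have "\<exists>k. 1 \<le> k \<and> k \<le> s \<and>
    psi_bar \<sigma> s d / 36 \<le> \<sigma> ^ 4 * (real k)\<^sup>2 * (ln (1 + real d / (2 * (real k)\<^sup>2)))\<^sup>2"
  proof (cases "real s < sqrt (real d)")
    case True
    define x where "x = real d / (real s)\<^sup>2"
    have "(ln (1 + x) / 2)\<^sup>2 \<le> (ln (1 + x / 2))\<^sup>2"
      by (intro power_mono ln_one_plus_half_ge) (auto simp: x_def)
    moreover have "(ln (1 + x) / 2)\<^sup>2 = (ln (1 + x))\<^sup>2 / 4"
      by (simp add: power_divide)
    \<comment> \<open>A factor 4 would do here; 36 is what the dense case needs.\<close>
    ultimately have "(ln (1 + x))\<^sup>2 / 36 \<le> (ln (1 + x / 2))\<^sup>2"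
      using zero_le_power2 [of "ln (1 + x)"] by linarith
    then have "\<sigma> ^ 4 * (real s)\<^sup>2 * ((ln (1 + x))\<^sup>2 / 36) \<le> \<sigma> ^ 4 * (real s)\<^sup>2 * (ln (1 + x / 2))\<^sup>2"
      by (intro mult_left_mono) auto
    moreover have "real d / (2 * (real s)\<^sup>2) = x / 2"
      by (simp add: x_def)
    ultimately show ?thesis
      using True assms(1) by (intro exI [of _ s]) (simp add: psi_bar_def x_def mult.commute [of 2])
  next
    case False
    \<comment> \<open>Then k \<le> s and k^2 \<le> d \<le> 4 k^2, so the logarithm is bounded below
      and k^2 has the order of d.\<close>
    define k where "k = nat \<lfloor>sqrt (real d)\<rfloor>"
    have "sqrt (real d) \<ge> 1"
      using assms by simp
    then have k: "1 \<le> k" "real k \<le> sqrt (real d)" "sqrt (real d) < real k + 1"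
      unfolding k_def by linarith+
    have "k \<le> s"
      using k False by linarith
    have "(sqrt (real d))\<^sup>2 \<le> (2 * real k)\<^sup>2"
      using k by (intro power_mono) auto
    then have d: "real d \<le> 4 * (real k)\<^sup>2"
      by (simp add: power_mult_distrib)
    have "(real k)\<^sup>2 \<le> (sqrt (real d))\<^sup>2"
      using k by (intro power_mono) auto
    then have "1 / 2 \<le> real d / (2 * (real k)\<^sup>2)"
      using k by (simp add: field_simps)
    \<comment> \<open>From ln (1 + x) \<le> x at x = -1/3, that is ln (2/3) \<le> -1/3. With d / 4
      \<le> k^2 this yields the constant 36 = 4 * 9.\<close>
    moreover have "ln (3 / 2 :: real) \<ge> 1 / 3"
      using ln_add_one_self_le_self2 [of "- 1 / 3 :: real"] ln_div [of 2 "3 :: real"] ln_div [of 3 "2 :: real"]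
      by simp
    moreover have "ln (3 / 2) \<le> ln (1 + y)" if "1 / 2 \<le> y" for y :: real
      using that by simp
    ultimately have "ln (1 + real d / (2 * (real k)\<^sup>2)) \<ge> 1 / 3"
      by (meson order_trans)
    then have "(1 / 3)\<^sup>2 \<le> (ln (1 + real d / (2 * (real k)\<^sup>2)))\<^sup>2"
      by (intro power_mono) auto
    then have "(real d / 4) * (1 / 9) \<le> (real k)\<^sup>2 * (ln (1 + real d / (2 * (real k)\<^sup>2)))\<^sup>2"
      using d by (intro mult_mono) (auto simp: power2_eq_square)
    then have "\<sigma> ^ 4 * ((real d / 4) * (1 / 9)) \<le> \<sigma> ^ 4 * ((real k)\<^sup>2 * (ln (1 + real d / (2 * (real k)\<^sup>2)))\<^sup>2)"
      by (intro mult_left_mono) auto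
    then show ?thesis
      using k(1) \<open>k \<le> s\<close> False by (intro exI [of _ k]) (simp add: psi_bar_def mult.assoc)
  qed
  then obtain k where k: "1 \<le> k" "k \<le> s"
    "psi_bar \<sigma> s d / 36 \<le> \<sigma> ^ 4 * (real k)\<^sup>2 * (ln (1 + real d / (2 * (real k)\<^sup>2)))\<^sup>2"
    by blast
  \<comment> \<open>The constant is 1/288 = 1/8 * 1/36.\<close>
  have "1 / 288 * min a p \<le> 1 / 8 * min a x" if "a \<ge> 0" "p / 36 \<le> x" for a p x :: real
    using that by (auto simp: min_def)
  from this [OF _ k(3)] show ?thesis
    by (rule order_trans [OF ennreal_leI * [OF k(1,2)]]) simp
qed

theorem theorem4:
  shows "\<exists>c::real. c > 0 \<and>
    (\<forall>(s::nat) (d::nat) (\<kappa>::real) (\<sigma>::real).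
       1 \<le> s \<longrightarrow> s \<le> d \<longrightarrow> \<kappa> > 0 \<longrightarrow> \<sigma> > 0 \<longrightarrow>
       (INF T\<in>estimators d. SUP \<theta>\<in>B2 d \<kappa> \<inter> B0 d s. risk d \<sigma> T \<theta>)
         \<ge> ennreal (c * psi_Q \<sigma> s d \<kappa>))"
proof (intro exI [of _ "1 / 288"] conjI allI impI)
  fix s d :: nat and \<kappa> \<sigma> :: real
  assume *: "1 \<le> s" "s \<le> d" "\<kappa> > 0" "\<sigma> > 0"
  have "ennreal (1 / 288 * min (\<kappa> ^ 4) (\<sigma>\<^sup>2 * \<kappa>\<^sup>2)) \<le> minimax_risk s d \<kappa> \<sigma>"
    by (rule order_trans [OF ennreal_leI minimax_risk_ge_two_points [OF *]])
       (intro mult_right_mono; simp)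
  \<comment> \<open>The maximum in \<open>psi_Q\<close> equals one of its two arguments, and each is
    covered by one of the two bounds.\<close>
  then show "ennreal (1 / 288 * psi_Q \<sigma> s d \<kappa>) \<le> minimax_risk s d \<kappa> \<sigma>"
    using minimax_risk_ge_sparse [OF *] by (simp add: psi_Q_def max_def)
qed simp

end
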